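(* Let $F:\Delta'_e\to\mathbb R$ be a Lipschitz differentiable function (in the sense defined in the context). Let $\overline F=\max_{\boldsymbol u\in\Delta'}F(\boldsymbol u)$ and $\underline F=\min_{\boldsymbol u\in\Delta'}F(\boldsymbol u)$ be the global maximum and minimum of $F$ restricted to $\Delta'$. Put $F_0:=F(\boldsymbol u^0)$ and, for $i\in\{1,\dots,d\}$, $$F_{iR}^{ub}:=\sigma\max_{\boldsymbol u\in\Delta'_e}\partial_iF(\boldsymbol u),\quad F_R^{ub}:=\max_iF_{iR}^{ub},\qquad F_{iR}^{lb}:=\sigma\min_{\boldsymbol u\in\Delta'_e}\partial_iF(\boldsymbol u),\quad F_R^{lb}:=\min_iF_{iR}^{lb}.$$ Let $i^1:=\arg\max_iF_{iR}^{ub}$, $i^2:=\arg\min_iF_{iR}^{lb}$, and let $\boldsymbol u^1,\boldsymbol u^2\in\Delta'$ be given by $u^1_i=\frac{n_i+s\delta_{ii^1}}{n+s}$ and $u^2_i=\frac{n_i+s\delta_{ii^2}}{n+s}$. Then $$F(\boldsymbol u^1)\sqsubseteq\overline F\sqsubseteq F_0+F_R^{ub}\qquad\text{and}\qquad F_0+F_R^{lb}\sqsubseteq\underline F\sqsubseteq F(\boldsymbol u^2).$$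
   Context: Fix $d\ge1$. For counts $\boldsymbol n=(n_1,\dots,n_d)\in\mathbb N_0^d$, $n=\sum_in_i$, and $s>0$ let $\sigma:=\frac{s}{n+s}$, $u_i^0:=\frac{n_i}{n+s}$ (so $\sigma=1-\sum_iu_i^0$), $$\Delta':=\{\boldsymbol u\in\mathbb R^d:u_i\ge u_i^0\ \forall i,\ \textstyle\sum_iu_i=1\},\qquad \Delta'_e:=\{\boldsymbol u\in\mathbb R^d:u_i\ge u_i^0\ \forall i,\ \textstyle\sum_iu_i\le1\}.$$ $\Delta:=\{\boldsymbol t\in\mathbb R^d:t_i\ge0\ \forall i,\sum_it_i=1\}$; points $\boldsymbol u\in\Delta'$ correspond to $\boldsymbol t\in\Delta$ through $u_i=\frac{n_i+st_i}{n+s}$. $\partial_iF$ is the partial derivative with respect to $u_i$; $\delta_{ij}$ is Kronecker's delta; ties in $\arg\max,\arg\min$ are broken arbitrarily. The function $F$ may also depend on $\boldsymbol n$ and $s$ (e.g. via $\sigma$ or $\boldsymbol u^0$), i.e. it is a family of functions on the sets $\Delta'_e$. $F$ is called Lipschitz differentiable if it is differentiable and there is a constant $c$, independent of any such parameters, with $|\partial_iF(\boldsymbol u)|\le c$ and $|\partial_iF(\boldsymbol u)-\partial_iF(\boldsymbol u')|\le c|\boldsymbol u-\boldsymbol u'|$ for all $\boldsymbol u,\boldsymbol u'\in\Delta'_e$ and all $i\in\{1,\dots,d\}$. Asymptotic notation: $g(\boldsymbol n,\boldsymbol t,s)=O(\sigma^k)$ means there is a constant $c$ such that $|g(\boldsymbol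 n,\boldsymbol t,s)|\le c\sigma^k$ for all $\boldsymbol n\in\mathbb N_0^d$, $\boldsymbol t\in\Delta$, $s>0$. $A\sqsubseteq B$ means: $A\le B$ and $A=B+O(\sigma^2)$. *)

theory Defs
  imports "HOL-Analysis.Analysis"
begin

text \<open>
  The dimension \<open>d \<ge> 1\<close> is the cardinality of the finite index type \<^typ>\<open>'d\<close>.
\<close>

definition total_count :: "nat ^ 'd \<Rightarrow> nat" where
  "total_count n = (\<Sum>i\<in>UNIV. n $ i)"

definition \<sigma> :: "nat ^ 'd \<Rightarrow> real \<Rightarrow> real" where
  "\<sigma> n s = s / (real (total_count n) + s)"

definition u0 :: "nat ^ 'd \<Rightarrow> real \<Rightarrow> real ^ 'd" where
  "u0 n s = (\<chi> i. real (n $ i) / (real (total_count n) + s))"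

definition Delta :: "(real ^ 'd) set" where
  "Delta = {t. (\<forall>i. t $ i \<ge> 0) \<and> (\<Sum>i\<in>UNIV. t $ i) = 1}"

definition Delta' :: "nat ^ 'd \<Rightarrow> real \<Rightarrow> (real ^ 'd) set" where
  "Delta' n s = {u. (\<forall>i. u $ i \<ge> u0 n s $ i) \<and> (\<Sum>i\<in>UNIV. u $ i) = 1}"

definition Delta'_e :: "nat ^ 'd \<Rightarrow> real \<Rightarrow> (real ^ 'd) set" where
  "Delta'_e n s = {u. (\<forall>i. u $ i \<ge> u0 n s $ i) \<and> (\<Sum>i\<in>UNIV. u $ i) \<le> 1}"

definition vertex :: "nat ^ 'd \<Rightarrow> real \<Rightarrow> 'd \<Rightarrow> real ^ 'd" where
  "vertex n s j = (\<chi> i. (real (n $ i) + s * of_bool (i = j)) / (real (total_count n) + s))"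

text \<open>
  A function that depends on the parameters \<open>n\<close> and \<open>s\<close> is a family
  \<open>F n s\<close>, of which only the values on \<open>Delta'_e n s\<close> matter.  At some boundary points of
  this set no segment in direction \<open>i\<close> stays in the set, so the partial derivative is
  taken to be the \<open>i\<close>-th component of the (total) derivative relative to the set.  That
  derivative is unique: see \<open>partial_eq\<close> below.
\<close>

definition partial ::
  "(nat ^ 'd \<Rightarrow> real \<Rightarrow> real ^ 'd \<Rightarrow> real) \<Rightarrow> nat ^ 'd \<Rightarrow> real \<Rightarrow> 'd::finite \<Rightarrow> real ^ 'd \<Rightarrow> real" where
  "partial F n s i u = frechet_derivative (F n s) (at u within Delta'_e n s) (axis i 1)"

definition lipschitz_differentiable ::
  "(nat ^ 'd \<Rightarrow> real \<Rightarrow> real ^ 'd \<Rightarrow> real) \<Rightarrow> bool" where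
  "lipschitz_differentiable F \<longleftrightarrow>
     (\<forall>n. \<forall>s>0. F n s differentiable_on Delta'_e n s) \<and>
     (\<exists>c. \<forall>n. \<forall>s>0. \<forall>u\<in>Delta'_e n s. \<forall>u'\<in>Delta'_e n s. \<forall>i.
        \<bar>partial F n s i u\<bar> \<le> c \<and>
        \<bar>partial F n s i u - partial F n s i u'\<bar> \<le> c * norm (u - u'))"

text \<open>
  Attained extrema, not suprema and infima: the values are unspecified if no
  extremum is attained.
\<close>

definition max_on :: "('a \<Rightarrow> real) \<Rightarrow> 'a set \<Rightarrow> real" where
  "max_on f S = (GREATEST y. y \<in> f ` S)"

definition min_on :: "('a \<Rightarrow> real) \<Rightarrow> 'a set \<Rightarrow> real" where
  "min_on f S = (LEAST y. y \<in> f ` S)"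

definition F_max :: "(nat ^ 'd \<Rightarrow> real \<Rightarrow> real ^ 'd \<Rightarrow> real) \<Rightarrow> nat ^ 'd \<Rightarrow> real \<Rightarrow> real" where
  "F_max F n s = max_on (F n s) (Delta' n s)"

definition F_min :: "(nat ^ 'd \<Rightarrow> real \<Rightarrow> real ^ 'd \<Rightarrow> real) \<Rightarrow> nat ^ 'd \<Rightarrow> real \<Rightarrow> real" where
  "F_min F n s = min_on (F n s) (Delta' n s)"

definition F_0 :: "(nat ^ 'd \<Rightarrow> real \<Rightarrow> real ^ 'd \<Rightarrow> real) \<Rightarrow> nat ^ 'd \<Rightarrow> real \<Rightarrow> real" where
  "F_0 F n s = F n s (u0 n s)"

definition F_iR_ub ::
  "(nat ^ 'd \<Rightarrow> real \<Rightarrow> real ^ 'd \<Rightarrow> real) \<Rightarrow> nat ^ 'd \<Rightarrow> real \<Rightarrow> 'd::finite \<Rightarrow> real" where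
  "F_iR_ub F n s i = \<sigma> n s * max_on (partial F n s i) (Delta'_e n s)"

definition F_iR_lb ::
  "(nat ^ 'd \<Rightarrow> real \<Rightarrow> real ^ 'd \<Rightarrow> real) \<Rightarrow> nat ^ 'd \<Rightarrow> real \<Rightarrow> 'd::finite \<Rightarrow> real" where
  "F_iR_lb F n s i = \<sigma> n s * min_on (partial F n s i) (Delta'_e n s)"

definition F_R_ub ::
  "(nat ^ 'd \<Rightarrow> real \<Rightarrow> real ^ 'd \<Rightarrow> real) \<Rightarrow> nat ^ 'd::finite \<Rightarrow> real \<Rightarrow> real" where
  "F_R_ub F n s = Max (range (F_iR_ub F n s))"

definition F_R_lb ::
  "(nat ^ 'd \<Rightarrow> real \<Rightarrow> real ^ 'd \<Rightarrow> real) \<Rightarrow> nat ^ 'd::finite \<Rightarrow> real \<Rightarrow> real" where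
  "F_R_lb F n s = Min (range (F_iR_lb F n s))"

text \<open>Uniform in all parameters, so not an instance of a Landau symbol along a filter.\<close>

definition bigO_sigma ::
  "nat \<Rightarrow> (nat ^ 'd \<Rightarrow> real ^ 'd \<Rightarrow> real \<Rightarrow> real) \<Rightarrow> bool" where
  "bigO_sigma k g \<longleftrightarrow> (\<exists>c. \<forall>n. \<forall>t\<in>Delta. \<forall>s>0. \<bar>g n t s\<bar> \<le> c * \<sigma> n s ^ k)"

definition sqle ::
  "(nat ^ 'd \<Rightarrow> real ^ 'd \<Rightarrow> real \<Rightarrow> real) \<Rightarrow> (nat ^ 'd \<Rightarrow> real ^ 'd \<Rightarrow> real \<Rightarrow> real) \<Rightarrow> bool"
  (infix "\<sqsubseteq>" 50) where
  "A \<sqsubseteq> B \<longleftrightarrow>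
     (\<forall>n. \<forall>t\<in>Delta. \<forall>s>0. A n t s \<le> B n t s) \<and>
     bigO_sigma 2 (\<lambda>n t s. A n t s - B n t s)"

lemma total_pos: "s > 0 \<Longrightarrow> real (total_count n) + s > 0"
  by (simp add: add_nonneg_pos)

lemma \<sigma>_pos: "s > 0 \<Longrightarrow> \<sigma> n s > 0"
  by (simp add: \<sigma>_def total_pos)

lemma sum_u0: "s > 0 \<Longrightarrow> (\<Sum>i\<in>UNIV. u0 n s $ i) = 1 - \<sigma> n s"
  using total_pos[of s n]
  by (simp add: u0_def \<sigma>_def total_count_def flip: sum_divide_distrib) (simp add: field_simps)

lemma u0_in_Delta'_e: "s > 0 \<Longrightarrow> u0 n s \<in> Delta'_e n s"
  using \<sigma>_pos[of s n] by (simp add: Delta'_e_def sum_u0)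

lemma vertex_eq: "vertex n s j = u0 n s + \<sigma> n s *\<^sub>R axis j 1"
  by (simp add: vertex_def u0_def \<sigma>_def vec_eq_iff axis_def add_divide_distrib)

lemma vertex_in_Delta':
  assumes "s > 0"
  shows "vertex n s j \<in> Delta' n s"
proof -
  have "(\<Sum>i\<in>UNIV. vertex n s j $ i) = (\<Sum>i\<in>UNIV. u0 n s $ i) + (\<Sum>i\<in>UNIV. if i = j then \<sigma> n s else 0)"
    unfolding sum.distrib[symmetric] by (intro sum.cong) (auto simp: vertex_eq axis_def)
  then have "(\<Sum>i\<in>UNIV. vertex n s j $ i) = 1"
    using assms by (simp add: sum_u0)
  then show ?thesis
    using \<sigma>_pos[OF assms, of n] by (simp add: Delta'_def vertex_eq axis_def)
qed

lemma Delta'_subset: "Delta' n s \<subseteq> Delta'_e n s"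
  by (auto simp: Delta'_def Delta'_e_def)

lemma convex_Delta'_e: "convex (Delta'_e n s)"
proof (rule convexI)
  fix x y :: "real ^ 'a" and a b :: real
  assume xy: "x \<in> Delta'_e n s" "y \<in> Delta'_e n s" and ab: "0 \<le> a" "0 \<le> b" "a + b = 1"
  have "u0 n s $ i \<le> a * x $ i + b * y $ i" for i
  proof -
    have "u0 n s $ i = a * u0 n s $ i + b * u0 n s $ i"
      using ab by (simp flip: distrib_right)
    also have "\<dots> \<le> a * x $ i + b * y $ i"
      using xy ab by (intro add_mono mult_left_mono) (auto simp: Delta'_e_def)
    finally show ?thesis .
  qed
  moreover have "a * (\<Sum>i\<in>UNIV. x $ i) + b * (\<Sum>i\<in>UNIV. y $ i) \<le> a * 1 + b * 1"
    using xy ab by (intro add_mono mult_left_mono) (auto simp: Delta'_e_def)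
  ultimately show "a *\<^sub>R x + b *\<^sub>R y \<in> Delta'_e n s"
    using ab by (simp add: Delta'_e_def sum.distrib sum_distrib_left)
qed

lemma derivative_unique_convex:
  fixes f :: "'a::real_normed_vector \<Rightarrow> real"
  assumes "convex S" "x \<in> S" "y \<in> S"
    and D1: "(f has_derivative D1) (at x within S)" and D2: "(f has_derivative D2) (at x within S)"
  shows "D1 (y - x) = D2 (y - x)"
proof -
  define p where "p t = x + t *\<^sub>R (y - x)" for t :: real
  have p: "(p has_vector_derivative (y - x)) (at 0 within {0..1})"
    unfolding p_def by (auto intro!: derivative_eq_intros)
  have sub: "p ` {0..1} \<subseteq> S"
  proof clarify
    fix t :: real assume "t \<in> {0..1}"
    then show "p t \<in> S"
      using convexD_alt[OF assms(1-3), of t] by (simp add: p_def algebra_simps)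
  qed
  have "((f \<circ> p) has_vector_derivative D (y - x)) (at 0 within {0..1})"
    if "(f has_derivative D) (at x within S)" for D
  proof -
    have "(f has_derivative D) (at (p 0) within p ` {0..1})"
      using has_derivative_subset[OF that sub] by (simp add: p_def)
    from vector_derivative_diff_chain_within[OF p this] show ?thesis .
  qed
  from this[OF D1] this[OF D2] show ?thesis
    by (intro vector_derivative_unique_within[of 0 "{0..1}" "f \<circ> p"])
       (auto simp: trivial_limit_within islimpt_Icc)
qed

lemma partial_eq:
  assumes "s > 0" "u \<in> Delta'_e n s"
    and D: "(F n s has_derivative D) (at u within Delta'_e n s)"
  shows "partial F n s i u = D (axis i 1)"
proof -
  let ?D = "frechet_derivative (F n s) (at u within Delta'_e n s)"
  have D': "(F n s has_derivative ?D) (at u within Delta'_e n s)"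
    using D frechet_derivative_works differentiable_def by blast
  have v: "vertex n s i \<in> Delta'_e n s" "u0 n s \<in> Delta'_e n s"
    using vertex_in_Delta' Delta'_subset u0_in_Delta'_e assms(1) by blast+
  have *: "\<sigma> n s * G (axis i 1) = G (vertex n s i - u) - G (u0 n s - u)"
    if "(F n s has_derivative G) (at u within Delta'_e n s)" for G
  proof -
    interpret bounded_linear G using that by (rule has_derivative_bounded_linear)
    show ?thesis by (simp add: vertex_eq scaleR flip: diff)
  qed
  have "\<sigma> n s * ?D (axis i 1) = \<sigma> n s * D (axis i 1)"
    unfolding *[OF D] *[OF D']
    using derivative_unique_convex[OF convex_Delta'_e assms(2) _ D' D] v by simp
  then show ?thesis
    using \<sigma>_pos[OF assms(1), of n] by (simp add: partial_def)
qed

end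

theory Submission
  imports Defs
begin

text \<open>
  By the mean value theorem, \<open>F u - F u0\<close> is a combination of the partial derivatives at some
  point of \<open>Delta'_e\<close>, with nonnegative weights \<open>u $ i - u0 $ i\<close> that add up to \<open>\<sigma>\<close> on
  \<open>Delta'\<close>.  Bounding each partial derivative by its maximum gives the upper bound for \<open>F_max\<close>.
  At the vertex belonging to the best index, only one partial derivative occurs; it differs from
  its maximum by \<open>O(\<sigma>)\<close>, because it is Lipschitz and \<open>Delta'_e\<close> has diameter at most \<open>2\<sigma>\<close>.
  So even the outer two terms of the chain differ only by \<open>O(\<sigma>\<^sup>2)\<close>.
  The bounds for the minimum are those for the maximum of \<open>-F\<close>.
\<close>

section \<open>Attained extrema on compact sets\<close>

lemma max_on_attained:
  assumes "compact S" "S \<noteq> {}" "continuous_on S f"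
  shows "\<exists>x\<in>S. max_on f S = f x \<and> (\<forall>y\<in>S. f y \<le> f x)"
proof -
  obtain x where x: "x \<in> S" "\<forall>y\<in>S. f y \<le> f x"
    using continuous_attains_sup[OF assms] by blast
  have "max_on f S = f x"
    unfolding max_on_def using x by (intro Greatest_equality) auto
  with x show ?thesis by blast
qed

text \<open>By compactness and continuity a minimum point of \<open>f\<close> exists, and it is a
  maximum point of \<open>-f\<close>. Without attainment both sides would be unspecified
  values.\<close>

lemma max_on_uminus:
  assumes "compact S" "S \<noteq> {}" "continuous_on S f"
  shows "max_on (\<lambda>x. - f x) S = - min_on f S"
proof -
  obtain x where x: "x \<in> S" "\<forall>y\<in>S. f x \<le> f y"
    using continuous_attains_inf[OF assms] by blast
  have "min_on f S = f x"
    unfolding min_on_def using x by (intro Least_equality) auto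
  moreover have "max_on (\<lambda>x. - f x) S = - f x"
    unfolding max_on_def using x by (intro Greatest_equality) auto
  ultimately show ?thesis by simp
qed

section \<open>Size and compactness of the simplices\<close>

lemma \<sigma>_nonneg: "s > 0 \<Longrightarrow> 0 \<le> \<sigma> n s"
  using \<sigma>_pos[of s n] by simp

text \<open>All coordinates of \<open>u - u0 n s\<close> are nonnegative, so its l1 norm is the
  plain coordinate sum, at most \<open>1 - (1 - \<sigma> n s)\<close>.\<close>

lemma norm_diff_u0_le:
  assumes "s > 0" "u \<in> Delta'_e n s"
  shows "norm (u - u0 n s) \<le> \<sigma> n s"
proof -
  have "norm (u - u0 n s) \<le> (\<Sum>i\<in>UNIV. \<bar>(u - u0 n s) $ i\<bar>)"
    by (rule norm_le_l1_cart)
  also have "\<dots> = (\<Sum>i\<in>UNIV. u $ i - u0 n s $ i)"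
    using assms by (intro sum.cong) (auto simp: Delta'_e_def)
  also have "\<dots> \<le> \<sigma> n s"
    using assms by (simp add: sum_subtractf sum_u0 Delta'_e_def)
  finally show ?thesis .
qed

lemma norm_diff_Delta'_e_le:
  assumes "s > 0" "u \<in> Delta'_e n s" "v \<in> Delta'_e n s"
  shows "norm (u - v) \<le> 2 * \<sigma> n s"
  using norm_triangle_ineq4[of "u - u0 n s" "v - u0 n s"]
    norm_diff_u0_le[OF assms(1,2)] norm_diff_u0_le[OF assms(1,3)] by simp

lemma compact_Delta'_e:
  assumes "s > 0"
  shows "compact (Delta'_e n s)"
proof -
  have "closed (Delta'_e n s)"
    unfolding Delta'_e_def
    by (intro closed_Collect_conj closed_Collect_all closed_Collect_le continuous_intros)
  moreover have "Delta'_e n s \<subseteq> cball (u0 n s) (\<sigma> n s)"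
    using norm_diff_u0_le[OF assms] by (auto simp: dist_norm norm_minus_commute)
  ultimately show ?thesis
    using bounded_subset[OF bounded_cball] by (auto simp: compact_eq_bounded_closed)
qed

lemma compact_Delta':
  fixes n :: "nat ^ 'd::finite"
  assumes "s > 0"
  shows "compact (Delta' n s)"
proof -
  have "Delta' n s = Delta'_e n s \<inter> {u. (\<Sum>i\<in>UNIV. u $ i) = 1}"
    by (auto simp: Delta'_def Delta'_e_def)
  moreover have "closed {u :: real ^ 'd. (\<Sum>i\<in>UNIV. u $ i) = 1}"
    by (intro closed_Collect_eq continuous_intros)
  ultimately show ?thesis
    using compact_Int_closed[OF compact_Delta'_e[OF assms, of n]] by simp
qed

lemma Delta'_nonempty: "s > 0 \<Longrightarrow> Delta' n s \<noteq> {}"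
  using vertex_in_Delta' by blast

lemma Delta'_e_nonempty: "s > 0 \<Longrightarrow> Delta'_e n s \<noteq> {}"
  using u0_in_Delta'_e by blast

section \<open>Mean value theorem and regularity of the partial derivatives\<close>

lemma lipschitz_differentiable_differentiable_on:
  "lipschitz_differentiable F \<Longrightarrow> s > 0 \<Longrightarrow> F n s differentiable_on Delta'_e n s"
  by (simp add: lipschitz_differentiable_def)

text \<open>The one-dimensional mean value theorem is applied along the segment from
  \<open>u0 n s\<close> to \<open>u\<close>, which stays in \<open>Delta'_e n s\<close> by
  convexity. Derivatives relative to the set suffice for the chain rule, so boundary points need no
  special care. Linearity then splits the derivative into partial ones.\<close>

lemma partial_mean_value:
  fixes F :: "nat ^ 'd::finite \<Rightarrow> real \<Rightarrow> real ^ 'd \<Rightarrow> real"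
  assumes F: "lipschitz_differentiable F" and s: "s > 0" and u: "u \<in> Delta'_e n s"
  shows "\<exists>x\<in>Delta'_e n s.
    F n s u - F n s (u0 n s) = (\<Sum>i\<in>UNIV. (u $ i - u0 n s $ i) * partial F n s i x)"
proof -
  let ?D = "Delta'_e n s" and ?a = "u0 n s"
  define p where "p t = ?a + t *\<^sub>R (u - ?a)" for t :: real
  have p_in: "p t \<in> ?D" if "t \<in> {0..1}" for t
    using convexD_alt[OF convex_Delta'_e u0_in_Delta'_e[OF s] u, of t] that
    by (simp add: p_def algebra_simps)
  let ?F' = "\<lambda>x. frechet_derivative (F n s) (at x within ?D)"
  have F': "(F n s has_derivative ?F' x) (at x within ?D)" if "x \<in> ?D" for x
    using lipschitz_differentiable_differentiable_on[OF F s] that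
    by (simp add: differentiable_on_def flip: frechet_derivative_works)
  have "((\<lambda>t. F n s (p t)) has_derivative (\<lambda>h. ?F' (p t) (h *\<^sub>R (u - ?a)))) (at t within {0..1})"
    if t: "t \<in> {0..1}" for t
  proof (rule has_derivative_in_compose2[of ?D])
    show "(p has_derivative (\<lambda>h. h *\<^sub>R (u - ?a))) (at t within {0..1})"
      unfolding p_def by (auto intro!: derivative_eq_intros)
  qed (use F' p_in t in auto)
  then obtain t where t: "t \<in> {0..1}"
    and eq: "F n s (p 1) - F n s (p 0) = ?F' (p t) ((1 - 0) *\<^sub>R (u - ?a))"
    using mvt_very_simple[of 0 1 "\<lambda>t. F n s (p t)" "\<lambda>t h. ?F' (p t) (h *\<^sub>R (u - ?a))"] by auto
  interpret bounded_linear "?F' (p t)"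
    using F'[OF p_in[OF t]] by (rule has_derivative_bounded_linear)
  have "u - ?a = (\<Sum>i\<in>UNIV. (u $ i - ?a $ i) *\<^sub>R axis i 1)"
    using basis_expansion[of "u - ?a"] by (simp add: scalar_mult_eq_scaleR)
  then have "?F' (p t) (u - ?a) = (\<Sum>i\<in>UNIV. (u $ i - ?a $ i) * partial F n s i (p t))"
    by (simp add: partial_def sum scaleR)
  with eq have "F n s u - F n s ?a = (\<Sum>i\<in>UNIV. (u $ i - ?a $ i) * partial F n s i (p t))"
    by (simp add: p_def)
  with p_in[OF t] show ?thesis by blast
qed

lemma lipschitz_differentiable_continuous_on:
  assumes "lipschitz_differentiable F" "s > 0"
  shows "continuous_on (Delta'_e n s) (F n s)" "continuous_on (Delta' n s) (F n s)"
proof -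
  show "continuous_on (Delta'_e n s) (F n s)"
    using assms
    by (intro differentiable_imp_continuous_on lipschitz_differentiable_differentiable_on)
  then show "continuous_on (Delta' n s) (F n s)"
    by (rule continuous_on_subset) (rule Delta'_subset)
qed

lemma lipschitz_differentiable_constant:
  assumes "lipschitz_differentiable F"
  shows "\<exists>c\<ge>0. \<forall>n. \<forall>s>0. \<forall>u\<in>Delta'_e n s. \<forall>v\<in>Delta'_e n s. \<forall>i.
    \<bar>partial F n s i u - partial F n s i v\<bar> \<le> c * norm (u - v)"
proof -
  obtain c where c: "\<forall>n. \<forall>s>0. \<forall>u\<in>Delta'_e n s. \<forall>v\<in>Delta'_e n s. \<forall>i.
      \<bar>partial F n s i u\<bar> \<le> c \<and> \<bar>partial F n s i u - partial F n s i v\<bar> \<le> c * norm (u - v)"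
    using assms unfolding lipschitz_differentiable_def by blast
  \<comment> \<open>The bound on the absolute value of \<open>partial\<close> at any single point
    forces \<open>c \<ge> 0\<close>; the parameters \<open>0\<close> and \<open>1\<close> supply
    such a point.\<close>
  have "u0 0 1 \<in> Delta'_e 0 1"
    by (rule u0_in_Delta'_e) simp
  then have "\<bar>partial F 0 1 undefined (u0 0 1)\<bar> \<le> c"
    using c[rule_format, of 1 "u0 0 1" 0 "u0 0 1" undefined] by simp
  then have "c \<ge> 0" by linarith
  with c show ?thesis by blast
qed

lemma continuous_on_partial:
  assumes "lipschitz_differentiable F" "s > 0"
  shows "continuous_on (Delta'_e n s) (partial F n s i)"
proof -
  obtain c where "c \<ge> 0" "\<And>n s u v i. \<lbrakk>s > 0; u \<in> Delta'_e n s; v \<in> Delta'_e n s\<rbrakk> \<Longrightarrow>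
       \<bar>partial F n s i u - partial F n s i v\<bar> \<le> c * norm (u - v)"
    using lipschitz_differentiable_constant[OF assms(1)] by blast
  then have "c-lipschitz_on (Delta'_e n s) (partial F n s i)"
    using assms(2) by (intro lipschitz_onI) (simp_all add: dist_norm)
  then show ?thesis by (rule lipschitz_on_continuous_on)
qed

section \<open>Bounds for the maximum\<close>

lemma partial_le_F_iR_ub:
  assumes "lipschitz_differentiable F" "s > 0" "u \<in> Delta'_e n s"
  shows "\<sigma> n s * partial F n s i u \<le> F_iR_ub F n s i"
proof -
  obtain x where "x \<in> Delta'_e n s" "max_on (partial F n s i) (Delta'_e n s) = partial F n s i x"
    "\<And>y. y \<in> Delta'_e n s \<Longrightarrow> partial F n s i y \<le> partial F n s i x"
    using max_on_attained[OF compact_Delta'_e[OF assms(2)] Delta'_e_nonempty[OF assms(2)]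
        continuous_on_partial[OF assms(1,2)]]
    by blast
  then show ?thesis
    using assms \<sigma>_nonneg by (auto simp: F_iR_ub_def intro!: mult_left_mono)
qed

lemma F_max_le:
  assumes F: "lipschitz_differentiable F" and s: "s > 0"
  shows "F_max F n s \<le> F_0 F n s + F_R_ub F n s"
proof -
  obtain u where u: "u \<in> Delta' n s" "F_max F n s = F n s u"
    unfolding F_max_def
    using max_on_attained[OF compact_Delta'[OF s] Delta'_nonempty[OF s]
        lipschitz_differentiable_continuous_on(2)[OF F s]]
    by blast
  then have ue: "u \<in> Delta'_e n s" using Delta'_subset by blast
  obtain x where x: "x \<in> Delta'_e n s"
    and eq: "F n s u - F n s (u0 n s) = (\<Sum>i\<in>UNIV. (u $ i - u0 n s $ i) * partial F n s i x)"
    using partial_mean_value[OF F s ue] by blast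
  \<comment> \<open>\<open>F_R_ub\<close> already contains the factor \<open>\<sigma> n s\<close>,
    so the whole identity is scaled by it; the positive factor is cancelled at the end.\<close>
  have "\<sigma> n s * (F n s u - F n s (u0 n s))
      = (\<Sum>i\<in>UNIV. (u $ i - u0 n s $ i) * (\<sigma> n s * partial F n s i x))"
    unfolding eq sum_distrib_left by (simp add: mult.left_commute)
  also have "\<dots> \<le> (\<Sum>i\<in>UNIV. (u $ i - u0 n s $ i) * F_R_ub F n s)"
  proof (intro sum_mono mult_left_mono)
    fix i
    show "\<sigma> n s * partial F n s i x \<le> F_R_ub F n s"
      by (rule order_trans[OF partial_le_F_iR_ub[OF F s x]]) (simp add: F_R_ub_def)
    show "0 \<le> u $ i - u0 n s $ i"
      using ue by (simp add: Delta'_e_def)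
  qed
  \<comment> \<open>On \<open>Delta'\<close> the weights add up to exactly
    \<open>\<sigma> n s\<close>, so this holds whatever the sign of
    \<open>F_R_ub F n s\<close>.\<close>
  also have "\<dots> = \<sigma> n s * F_R_ub F n s"
    using u s by (simp add: sum_u0 sum_subtractf Delta'_def flip: sum_distrib_right)
  finally show ?thesis
    using u \<sigma>_pos[OF s, of n] by (simp add: F_0_def)
qed

lemma F_vertex_le_F_max:
  assumes "lipschitz_differentiable F" "s > 0"
  shows "F n s (vertex n s j) \<le> F_max F n s"
  unfolding F_max_def
  using max_on_attained[OF compact_Delta'[OF assms(2)] Delta'_nonempty[OF assms(2)]
        lipschitz_differentiable_continuous_on(2)[OF assms, of n]]
    vertex_in_Delta'[OF assms(2), of n j]
  by auto

text \<open>The error \<open>2 * c * (\<sigma> n s)\<^sup>2\<close> collects one factor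
  \<open>\<sigma> n s\<close> from the weight of the only surviving partial derivative and
  \<open>2 * \<sigma> n s\<close> from the distance between the mean value point and the maximum
  point.\<close>

lemma F_iR_ub_le_vertex:
  assumes F: "lipschitz_differentiable F" and s: "s > 0" and "c \<ge> 0"
    and c: "\<And>u v. \<lbrakk>u \<in> Delta'_e n s; v \<in> Delta'_e n s\<rbrakk> \<Longrightarrow>
      \<bar>partial F n s j u - partial F n s j v\<bar> \<le> c * norm (u - v)"
  shows "F_0 F n s + F_iR_ub F n s j \<le> F n s (vertex n s j) + 2 * c * (\<sigma> n s)\<^sup>2"
proof -
  have "vertex n s j \<in> Delta'_e n s"
    using vertex_in_Delta'[OF s] Delta'_subset by blast
  then obtain x where x: "x \<in> Delta'_e n s"
    and eq: "F n s (vertex n s j) - F n s (u0 n s)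
      = (\<Sum>i\<in>UNIV. (vertex n s j $ i - u0 n s $ i) * partial F n s i x)"
    using partial_mean_value[OF F s] by blast
  have "(\<Sum>i\<in>UNIV. (vertex n s j $ i - u0 n s $ i) * partial F n s i x)
      = (\<Sum>i\<in>UNIV. if i = j then \<sigma> n s * partial F n s i x else 0)"
    by (intro sum.cong) (auto simp: vertex_eq axis_def)
  with eq have eq': "F n s (vertex n s j) = F n s (u0 n s) + \<sigma> n s * partial F n s j x"
    by simp
  obtain y where y: "y \<in> Delta'_e n s" "F_iR_ub F n s j = \<sigma> n s * partial F n s j y"
    unfolding F_iR_ub_def
    using max_on_attained[OF compact_Delta'_e[OF s] Delta'_e_nonempty[OF s]
        continuous_on_partial[OF F s, of n j]]
    by metis
  have "partial F n s j y - partial F n s j x \<le> c * norm (y - x)"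
    using c[OF y(1) x] by simp
  also have "\<dots> \<le> c * (2 * \<sigma> n s)"
    using norm_diff_Delta'_e_le[OF s y(1) x] \<open>c \<ge> 0\<close> by (intro mult_left_mono)
  finally have "\<sigma> n s * (partial F n s j y - partial F n s j x) \<le> \<sigma> n s * (c * (2 * \<sigma> n s))"
    using \<sigma>_nonneg[OF s] by (intro mult_left_mono)
  then show ?thesis
    unfolding F_0_def eq' y(2) by (simp add: algebra_simps power2_eq_square)
qed

text \<open>Both gaps are nonnegative and add up to \<open>C - A\<close>, so one bound on the outer
  gap controls each of them.\<close>

lemma sqle_sandwich:
  assumes "\<And>n t s. s > 0 \<Longrightarrow> A n t s \<le> B n t s" "\<And>n t s. s > 0 \<Longrightarrow> B n t s \<le> C n t s"
    and "\<And>n t s. s > 0 \<Longrightarrow> C n t s \<le> A n t s + k * (\<sigma> n s)\<^sup>2"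
  shows "A \<sqsubseteq> B" "B \<sqsubseteq> C"
proof -
  have "\<bar>A n t s - B n t s\<bar> \<le> k * (\<sigma> n s)\<^sup>2" "\<bar>B n t s - C n t s\<bar> \<le> k * (\<sigma> n s)\<^sup>2" if "s > 0" for n t s
    using assms[OF that, of n t] by linarith+
  then show "A \<sqsubseteq> B" "B \<sqsubseteq> C"
    unfolding sqle_def bigO_sigma_def using assms by blast+
qed

text \<open>Stated for an arbitrary family and an arbitrary selection \<open>j\<close> of maximizing
  indices, so that it also applies to \<open>-F\<close>. The constant \<open>c\<close> is fixed
  before \<open>n\<close> and \<open>s\<close>, which makes the error uniform.\<close>

lemma sqle_F_max:
  fixes F :: "nat ^ 'd::finite \<Rightarrow> real \<Rightarrow> real ^ 'd \<Rightarrow> real"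
  assumes F: "lipschitz_differentiable F"
    and j: "\<And>n s. s > 0 \<Longrightarrow> is_arg_max (F_iR_ub F n s) (\<lambda>_. True) (j n s)"
  shows "(\<lambda>n t s. F n s (vertex n s (j n s))) \<sqsubseteq> (\<lambda>n t s. F_max F n s)"
    and "(\<lambda>n t s. F_max F n s) \<sqsubseteq> (\<lambda>n t s. F_0 F n s + F_R_ub F n s)"
proof -
  obtain c where c: "c \<ge> 0"
    "\<And>n s u v i. \<lbrakk>s > 0; u \<in> Delta'_e n s; v \<in> Delta'_e n s\<rbrakk> \<Longrightarrow>
       \<bar>partial F n s i u - partial F n s i v\<bar> \<le> c * norm (u - v)"
    using lipschitz_differentiable_constant[OF F] by blast
  have "F_R_ub F n s = F_iR_ub F n s (j n s)" if "s > 0" for n s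
    unfolding F_R_ub_def using j[OF that, of n]
    by (intro Max_eqI) (auto simp: is_arg_max_linorder)
  then have close: "F_0 F n s + F_R_ub F n s \<le> F n s (vertex n s (j n s)) + 2 * c * (\<sigma> n s)\<^sup>2"
    if "s > 0" for n s
    using F_iR_ub_le_vertex[OF F that c(1)] c(2) that by simp
  show "(\<lambda>n t s. F n s (vertex n s (j n s))) \<sqsubseteq> (\<lambda>n t s. F_max F n s)"
    by (rule sqle_sandwich(1)[OF F_vertex_le_F_max[OF F] F_max_le[OF F] close])
  show "(\<lambda>n t s. F_max F n s) \<sqsubseteq> (\<lambda>n t s. F_0 F n s + F_R_ub F n s)"
    by (rule sqle_sandwich(2)[OF F_vertex_le_F_max[OF F] F_max_le[OF F] close])
qed

section \<open>Transfer to the minimum by negation\<close>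

lemma partial_uminus:
  assumes "lipschitz_differentiable F" "s > 0" "u \<in> Delta'_e n s"
  shows "partial (\<lambda>n s u. - F n s u) n s i u = - partial F n s i u"
proof -
  have "(F n s has_derivative frechet_derivative (F n s) (at u within Delta'_e n s))
      (at u within Delta'_e n s)"
    using lipschitz_differentiable_differentiable_on[OF assms(1,2)] assms(3)
    by (simp add: differentiable_on_def flip: frechet_derivative_works)
  \<comment> \<open>\<open>frechet_derivative\<close> is a choice among derivatives;
    \<open>partial_eq\<close> shows that its value on axis vectors does not depend on the
    choice.\<close>
  from partial_eq[where F = "\<lambda>n s u. - F n s u", OF assms(2,3) has_derivative_minus[OF this]]
  show ?thesis by (simp add: partial_def)
qed

lemma lipschitz_differentiable_uminus:
  assumes "lipschitz_differentiable F"
  shows "lipschitz_differentiable (\<lambda>n s u. - F n s u)"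
  using assms partial_uminus[OF assms]
  unfolding lipschitz_differentiable_def
  by (simp add: differentiable_on_def differentiable_minus abs_minus_commute)

lemma F_max_uminus:
  assumes "lipschitz_differentiable F" "s > 0"
  shows "F_max (\<lambda>n s u. - F n s u) n s = - F_min F n s"
  using assms
  by (simp add: F_max_def F_min_def max_on_uminus compact_Delta' Delta'_nonempty
      lipschitz_differentiable_continuous_on)

lemma F_iR_ub_uminus:
  assumes "lipschitz_differentiable F" "s > 0"
  shows "F_iR_ub (\<lambda>n s u. - F n s u) n s i = - F_iR_lb F n s i"
proof -
  \<comment> \<open>The two functions are known to agree only on \<open>Delta'_e n s\<close>, but
    \<open>max_on\<close> sees only the image of that set.\<close>
  have "max_on (partial (\<lambda>n s u. - F n s u) n s i) (Delta'_e n s)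
      = max_on (\<lambda>u. - partial F n s i u) (Delta'_e n s)"
    unfolding max_on_def using partial_uminus[OF assms] by (simp cong: image_cong)
  then show ?thesis
    using assms
    by (simp add: F_iR_ub_def F_iR_lb_def max_on_uminus compact_Delta'_e Delta'_e_nonempty
        continuous_on_partial)
qed

lemma F_R_ub_uminus:
  fixes F :: "nat ^ 'd::finite \<Rightarrow> real \<Rightarrow> real ^ 'd \<Rightarrow> real"
  assumes "lipschitz_differentiable F" "s > 0"
  shows "F_R_ub (\<lambda>n s u. - F n s u) n s = - F_R_lb F n s"
  using minus_Min_eq_Max[of "range (F_iR_lb F n s)"]
  by (simp add: F_R_ub_def F_R_lb_def F_iR_ub_uminus[OF assms] image_image)

text \<open>Negation reverses the order and preserves the absolute difference, so the same constant
  works. Equality is asked only for \<open>s > 0\<close>, where the extrema are known to be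
  attained.\<close>

lemma sqle_uminusD:
  assumes "A \<sqsubseteq> B" "\<And>n t s. s > 0 \<Longrightarrow> A n t s = - A' n t s" "\<And>n t s. s > 0 \<Longrightarrow> B n t s = - B' n t s"
  shows "B' \<sqsubseteq> A'"
  using assms by (auto simp: sqle_def bigO_sigma_def) blast

theorem theorem4:
  fixes F :: "nat ^ 'd::finite \<Rightarrow> real \<Rightarrow> real ^ 'd \<Rightarrow> real"
    and i1 i2 :: "nat ^ 'd \<Rightarrow> real \<Rightarrow> 'd"
  assumes "lipschitz_differentiable F"
    and "\<And>n s. s > 0 \<Longrightarrow> is_arg_max (F_iR_ub F n s) (\<lambda>_. True) (i1 n s)"
    and "\<And>n s. s > 0 \<Longrightarrow> is_arg_min (F_iR_lb F n s) (\<lambda>_. True) (i2 n s)"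
  shows "((\<lambda>n t s. F n s (vertex n s (i1 n s))) \<sqsubseteq> (\<lambda>n t s. F_max F n s) \<and>
          (\<lambda>n t s. F_max F n s) \<sqsubseteq> (\<lambda>n t s. F_0 F n s + F_R_ub F n s)) \<and>
         ((\<lambda>n t s. F_0 F n s + F_R_lb F n s) \<sqsubseteq> (\<lambda>n t s. F_min F n s) \<and>
          (\<lambda>n t s. F_min F n s) \<sqsubseteq> (\<lambda>n t s. F n s (vertex n s (i2 n s))))"
proof (intro conjI)
  show "(\<lambda>n t s. F n s (vertex n s (i1 n s))) \<sqsubseteq> (\<lambda>n t s. F_max F n s)"
    and "(\<lambda>n t s. F_max F n s) \<sqsubseteq> (\<lambda>n t s. F_0 F n s + F_R_ub F n s)"
    by (rule sqle_F_max[OF assms(1,2)]; assumption)+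
  let ?G = "\<lambda>n s u. - F n s u"
  \<comment> \<open>Minimizing \<open>F_iR_lb F n s\<close> is the same as maximizing its negative,
    so \<open>i2\<close> selects the vertex for \<open>-F\<close>.\<close>
  have "is_arg_max (F_iR_ub ?G n s) (\<lambda>_. True) (i2 n s)" if "s > 0" for n s
    using assms(3)[OF that, of n]
    by (simp add: is_arg_max_def is_arg_min_def F_iR_ub_uminus[OF assms(1) that])
  note G = sqle_F_max[OF lipschitz_differentiable_uminus[OF assms(1)] this]
  show "(\<lambda>n t s. F_0 F n s + F_R_lb F n s) \<sqsubseteq> (\<lambda>n t s. F_min F n s)"
    by (rule sqle_uminusD[OF G(2)])
      (simp_all add: F_max_uminus F_R_ub_uminus F_0_def assms(1))
  show "(\<lambda>n t s. F_min F n s) \<sqsubseteq> (\<lambda>n t s. F n s (vertex n s (i2 n s)))"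
    by (rule sqle_uminusD[OF G(1)]) (simp_all add: F_max_uminus assms(1))
qed

end
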